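(* Let $n\ge 2$ and let $Br_n(S^2)$ be the braid group of the sphere on $n$ strings, with standard generators $\delta_1,\dots,\delta_{n-1}$. Put $\delta=\delta_1\delta_2\cdots\delta_{n-1}$. Then $Br_n(S^2)$ has a presentation with two generators $\delta_1,\delta$ and relations $$\begin{cases} \delta_1\delta^i\delta_1\delta^{-i}=\delta^i\delta_1\delta^{-i}\delta_1 & \text{for } 2\le i\le n/2,\\ \delta^n=(\delta\delta_1)^{n-1},\\ \delta^n(\delta_1\delta^{-1})^{n-1}=1. \end{cases}$$
   Context: $Br_n(S^2)$ is the group with the (Zariski, Fadell--Van Buskirk) presentation with generators $\delta_i$, $i=1,\dots,n-1$, and relations: $\delta_i\delta_j=\delta_j\delta_i$ if $|i-j|>1$; $\delta_i\delta_{i+1}\delta_i=\delta_{i+1}\delta_i\delta_{i+1}$ for $1\le i\le n-2$; $\delta_1\delta_2\cdots\delta_{n-2}\delta_{n-1}^2\delta_{n-2}\cdots\delta_2\delta_1=1$. This presentation may be taken as the definition. *)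

theory Defs
  imports "HOL-Algebra.Algebra"
begin

section \<open>Groups given by generators and relations\<close>

text \<open>A letter \<open>(x, True)\<close> stands for the generator \<open>x\<close> and \<open>(x, False)\<close> for its formal inverse.
  A relation \<open>l = r\<close> is the pair \<open>(l, r)\<close> of words.\<close>

type_synonym 'a word = "('a \<times> bool) list"

definition words :: "'a set \<Rightarrow> 'a word set" where
  "words S = lists (S \<times> UNIV)"

definition gen :: "'a \<Rightarrow> 'a word" where
  "gen x = [(x, True)]"

definition word_inv :: "'a word \<Rightarrow> 'a word" where
  "word_inv w = rev (map (\<lambda>(x, b). (x, \<not> b)) w)"

definition word_pow :: "'a word \<Rightarrow> nat \<Rightarrow> 'a word" where
  "word_pow w k = concat (replicate k w)"

text \<open>The congruence on the free monoid of words over \<open>S\<close> generated by the cancellations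
  \<open>x x\<inverse> = x\<inverse> x = 1\<close> and by the relations \<open>R\<close>.\<close>

inductive pres_eq :: "'a set \<Rightarrow> ('a word \<times> 'a word) set \<Rightarrow> 'a word \<Rightarrow> 'a word \<Rightarrow> bool"
  for S :: "'a set" and R :: "('a word \<times> 'a word) set" where
  cancel: "x \<in> S \<Longrightarrow> pres_eq S R [(x, b), (x, \<not> b)] []"
| relation: "(l, r) \<in> R \<Longrightarrow> l \<in> words S \<Longrightarrow> r \<in> words S \<Longrightarrow> pres_eq S R l r"
| reflexive: "w \<in> words S \<Longrightarrow> pres_eq S R w w"
| symmetric: "pres_eq S R u v \<Longrightarrow> pres_eq S R v u"
| transitive: "pres_eq S R u v \<Longrightarrow> pres_eq S R v w \<Longrightarrow> pres_eq S R u w"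
| append: "pres_eq S R u v \<Longrightarrow> pres_eq S R u' v' \<Longrightarrow> pres_eq S R (u @ u') (v @ v')"

definition pres_class :: "'a set \<Rightarrow> ('a word \<times> 'a word) set \<Rightarrow> 'a word \<Rightarrow> 'a word set" where
  "pres_class S R w = {v. pres_eq S R w v}"

definition presented_group :: "'a set \<Rightarrow> ('a word \<times> 'a word) set \<Rightarrow> 'a word set monoid" where
  "presented_group S R =
    \<lparr>carrier = pres_class S R ` words S,
     monoid.mult = (\<lambda>A B. \<Union>u\<in>A. \<Union>v\<in>B. pres_class S R (u @ v)),
     monoid.one = pres_class S R []\<rparr>"

text \<open>The group \<open>G\<close> is presented by the generators \<open>S\<close>, interpreted in \<open>G\<close> by \<open>f\<close>, and the
  relations \<open>R\<close>. The map \<open>f\<close> is not required to be injective.\<close>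

definition has_presentation ::
  "('g, 'm) monoid_scheme \<Rightarrow> 'a set \<Rightarrow> ('a \<Rightarrow> 'g) \<Rightarrow> ('a word \<times> 'a word) set \<Rightarrow> bool" where
  "has_presentation G S f R \<longleftrightarrow>
     group G \<and> f \<in> S \<rightarrow> carrier G \<and> R \<subseteq> words S \<times> words S \<and>
     (\<exists>\<phi> \<in> iso (presented_group S R) G. \<forall>x\<in>S. \<phi> (pres_class S R (gen x)) = f x)"

lemma words_simps [simp]:
  "[] \<in> words S"
  "p # w \<in> words S \<longleftrightarrow> fst p \<in> S \<and> w \<in> words S"
  "u @ v \<in> words S \<longleftrightarrow> u \<in> words S \<and> v \<in> words S"
  "gen x \<in> words S \<longleftrightarrow> x \<in> S"
  by (cases p; auto simp: words_def gen_def)+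

lemma word_inv_words [simp]: "word_inv w \<in> words S \<longleftrightarrow> w \<in> words S"
  by (induction w) (auto simp: word_inv_def)

lemma word_pow_words [simp]: "w \<in> words S \<Longrightarrow> word_pow w k \<in> words S"
  by (induction k) (auto simp: word_pow_def)

lemma pres_eq_words: "pres_eq S R u v \<Longrightarrow> u \<in> words S \<and> v \<in> words S"
  by (induction rule: pres_eq.induct) auto

lemma pres_class_eq_iff:
  assumes "u \<in> words S"
  shows "pres_class S R u = pres_class S R v \<longleftrightarrow> pres_eq S R u v"
proof
  assume "pres_class S R u = pres_class S R v"
  moreover have "u \<in> pres_class S R u"
    using assms by (simp add: pres_class_def pres_eq.reflexive)
  ultimately show "pres_eq S R u v"
    by (auto simp: pres_class_def intro: pres_eq.symmetric)
next
  assume "pres_eq S R u v"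
  then have "pres_eq S R u w \<longleftrightarrow> pres_eq S R v w" for w
    using pres_eq.symmetric pres_eq.transitive by meson
  then show "pres_class S R u = pres_class S R v"
    by (simp add: pres_class_def)
qed

lemma presented_group_mult:
  assumes "u \<in> words S" "v \<in> words S"
  shows "pres_class S R u \<otimes>\<^bsub>presented_group S R\<^esub> pres_class S R v = pres_class S R (u @ v)"
proof -
  have "pres_class S R (u' @ v') = pres_class S R (u @ v)"
    if "u' \<in> pres_class S R u" "v' \<in> pres_class S R v" for u' v'
  proof -
    have "pres_eq S R (u @ v) (u' @ v')"
      using that by (simp add: pres_class_def pres_eq.append)
    then show ?thesis
      using assms pres_class_eq_iff[of "u @ v" S R "u' @ v'"] by simp
  qed
  then have "(\<Union>u'\<in>pres_class S R u. \<Union>v'\<in>pres_class S R v. pres_class S R (u' @ v')) =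
      (\<Union>u'\<in>pres_class S R u. \<Union>v'\<in>pres_class S R v. pres_class S R (u @ v))"
    by (intro SUP_cong refl) blast
  moreover have "pres_class S R u \<noteq> {}" "pres_class S R v \<noteq> {}"
    using assms by (auto simp: pres_class_def intro: pres_eq.reflexive)
  ultimately show ?thesis
    unfolding presented_group_def by simp
qed

lemma pres_eq_word_inv:
  assumes "w \<in> words S"
  shows "pres_eq S R (word_inv w @ w) []"
  using assms
proof (induction w)
  case Nil
  then show ?case by (simp add: word_inv_def pres_eq.reflexive)
next
  case (Cons p w)
  obtain x b where p: "p = (x, b)" by fastforce
  have x: "x \<in> S" and w: "w \<in> words S" using Cons.prems p by auto
  have "pres_eq S R [(x, \<not> b), (x, b)] []"
    using pres_eq.cancel[OF x, of R "\<not> b"] by simp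
  from pres_eq.append[OF this pres_eq.reflexive[OF w]]
  have "pres_eq S R ((x, \<not> b) # (x, b) # w) w" by simp
  from pres_eq.append[OF pres_eq.reflexive this, of "word_inv w"] w
  have "pres_eq S R (word_inv w @ (x, \<not> b) # (x, b) # w) (word_inv w @ w)" by simp
  from pres_eq.transitive[OF this Cons.IH[OF w]]
  have "pres_eq S R (word_inv w @ (x, \<not> b) # (x, b) # w) []" .
  then show ?case by (simp add: p word_inv_def)
qed

lemma group_presented_group: "group (presented_group S R)"
proof (rule groupI)
  have carr: "carrier (presented_group S R) = pres_class S R ` words S"
    and one: "\<one>\<^bsub>presented_group S R\<^esub> = pres_class S R []"
    by (simp_all add: presented_group_def)
  show "\<one>\<^bsub>presented_group S R\<^esub> \<in> carrier (presented_group S R)"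
    by (simp add: carr one)
  show "x \<otimes>\<^bsub>presented_group S R\<^esub> y \<in> carrier (presented_group S R)"
    if "x \<in> carrier (presented_group S R)" "y \<in> carrier (presented_group S R)" for x y
    using that by (auto simp: carr presented_group_mult)
  show "x \<otimes>\<^bsub>presented_group S R\<^esub> y \<otimes>\<^bsub>presented_group S R\<^esub> z =
      x \<otimes>\<^bsub>presented_group S R\<^esub> (y \<otimes>\<^bsub>presented_group S R\<^esub> z)"
    if "x \<in> carrier (presented_group S R)" "y \<in> carrier (presented_group S R)"
      "z \<in> carrier (presented_group S R)" for x y z
    using that by (auto simp: carr presented_group_mult)
  show "\<one>\<^bsub>presented_group S R\<^esub> \<otimes>\<^bsub>presented_group S R\<^esub> x = x"
    if "x \<in> carrier (presented_group S R)" for x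
    using that by (auto simp: carr one presented_group_mult)
  show "\<exists>y\<in>carrier (presented_group S R). y \<otimes>\<^bsub>presented_group S R\<^esub> x = \<one>\<^bsub>presented_group S R\<^esub>"
    if x: "x \<in> carrier (presented_group S R)" for x
  proof -
    obtain w where w: "w \<in> words S" "x = pres_class S R w"
      using x by (auto simp: carr)
    have "pres_class S R (word_inv w) \<otimes>\<^bsub>presented_group S R\<^esub> x = \<one>\<^bsub>presented_group S R\<^esub>"
      using w by (simp add: presented_group_mult one pres_class_eq_iff pres_eq_word_inv)
    then show ?thesis using w(1) by (auto simp: carr)
  qed
qed


section \<open>The braid group of the sphere\<close>

definition sphere_gens :: "nat \<Rightarrow> nat set" where
  "sphere_gens n = {1..n - 1}"

definition sphere_rels :: "nat \<Rightarrow> (nat word \<times> nat word) set" where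
  "sphere_rels n =
     {(gen i @ gen j, gen j @ gen i) | i j.
        i \<in> {1..n - 1} \<and> j \<in> {1..n - 1} \<and> \<bar>int i - int j\<bar> > 1} \<union>
     {(gen i @ gen (i + 1) @ gen i, gen (i + 1) @ gen i @ gen (i + 1)) | i.
        1 \<le> i \<and> i \<le> n - 2} \<union>
     {(concat (map gen [1..<n - 1]) @ word_pow (gen (n - 1)) 2 @ concat (map gen (rev [1..<n - 1])),
       [])}"

definition sphere_braid_group :: "nat \<Rightarrow> nat word set monoid" where
  "sphere_braid_group n = presented_group (sphere_gens n) (sphere_rels n)"

definition sphere_delta_i :: "nat \<Rightarrow> nat \<Rightarrow> nat word set" where
  "sphere_delta_i n i = pres_class (sphere_gens n) (sphere_rels n) (gen i)"

definition sphere_delta :: "nat \<Rightarrow> nat word set" where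
  "sphere_delta n =
     foldr (\<lambda>x y. x \<otimes>\<^bsub>sphere_braid_group n\<^esub> y) (map (sphere_delta_i n) [1..<n])
       \<one>\<^bsub>sphere_braid_group n\<^esub>"

lemma sphere_rels_words:
  assumes "n \<ge> 2"
  shows "sphere_rels n \<subseteq> words (sphere_gens n) \<times> words (sphere_gens n)"
proof -
  have *: "concat (map gen xs) \<in> words A" if "set xs \<subseteq> A" for xs and A :: "nat set"
    using that by (induction xs) auto
  have "concat (map gen [1..<n - 1]) \<in> words (sphere_gens n)"
    "concat (map gen (rev [1..<n - 1])) \<in> words (sphere_gens n)"
    by (rule *; auto simp: sphere_gens_def)+
  with assms show ?thesis
    by (auto simp: sphere_rels_def sphere_gens_def)
qed


section \<open>The relations in two generators\<close>

datatype two_gen = Delta1 | Delta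

definition two_gen_interp :: "nat \<Rightarrow> two_gen \<Rightarrow> nat word set" where
  "two_gen_interp n g = (case g of Delta1 \<Rightarrow> sphere_delta_i n 1 | Delta \<Rightarrow> sphere_delta n)"

definition two_gen_rels :: "nat \<Rightarrow> (two_gen word \<times> two_gen word) set" where
  "two_gen_rels n =
     {(gen Delta1 @ word_pow (gen Delta) i @ gen Delta1 @ word_inv (word_pow (gen Delta) i),
       word_pow (gen Delta) i @ gen Delta1 @ word_inv (word_pow (gen Delta) i) @ gen Delta1) | i.
        2 \<le> i \<and> real i \<le> real n / 2} \<union>
     {(word_pow (gen Delta) n, word_pow (gen Delta @ gen Delta1) (n - 1))} \<union>
     {(word_pow (gen Delta) n @ word_pow (gen Delta1 @ word_inv (gen Delta)) (n - 1), [])}"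

lemma two_gen_rels_words: "two_gen_rels n \<subseteq> words {Delta1, Delta} \<times> words {Delta1, Delta}"
  by (auto simp: two_gen_rels_def)

end

theory Submission
  imports Defs
begin

text \<open>In the sphere braid group, put \<open>\<delta> = \<delta>\<^sub>1 \<cdots> \<delta>\<^bsub>n-1\<^esub>\<close>. The braid relations give
  \<open>\<delta> \<delta>\<^sub>i = \<delta>\<^bsub>i+1\<^esub> \<delta>\<close>, so \<open>\<delta>\<^sub>i = \<delta>\<^bsup>i-1\<^esup> \<delta>\<^sub>1 \<delta>\<^bsup>-(i-1)\<^esup>\<close>, and pushing powers of \<open>\<delta>\<close> to the right
  turns \<open>(\<delta> \<delta>\<^sub>1)\<^bsup>n-1\<^esup>\<close> into \<open>\<delta>\<^bsup>n\<^esup>\<close>. Conversely, let \<open>a\<close> and \<open>d\<close> satisfy the relations in two generators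
  and put \<open>s\<^sub>i = d\<^bsup>i-1\<^esup> a d\<^bsup>-(i-1)\<^esup>\<close>. Since \<open>d\<^bsup>n\<^esup>\<close> is a power of \<open>d a\<close> it commutes with \<open>d\<close> and \<open>d a\<close>,
  hence is central, and the sequence \<open>s\<close> has period \<open>n\<close>; so commutation at distances up to \<open>n/2\<close>
  gives it at all distances up to \<open>n - 2\<close>. The relation \<open>d\<^bsup>n\<^esup> = (d a)\<^bsup>n-1\<^esup>\<close> says that
  \<open>d = s\<^sub>1 \<cdots> s\<^bsub>n-1\<^esub>\<close>, and cancelling \<open>s\<^sub>3 \<cdots> s\<^bsub>n-1\<^esub>\<close> in \<open>d s\<^sub>1 = s\<^sub>2 d\<close> leaves the braid relation.
  In both groups \<open>\<delta> (\<delta>\<^bsub>n-1\<^esub> \<cdots> \<delta>\<^sub>1)\<close> is conjugate to \<open>\<delta>\<^bsup>n\<^esup> (\<delta>\<^sub>1 \<delta>\<^bsup>-1\<^esup>)\<^bsup>n-1\<^esup>\<close>.\<close>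

section \<open>Homomorphisms out of presented groups\<close>

text \<open>Values are assigned to raw, unreduced words, so that well-definedness on classes is a
  separate matter, settled by \<open>word_eval_pres_eq\<close>.\<close>

definition word_eval :: "('g, 'm) monoid_scheme \<Rightarrow> ('a \<Rightarrow> 'g) \<Rightarrow> 'a word \<Rightarrow> 'g" where
  "word_eval G f w =
     foldr (\<lambda>p y. (if snd p then f (fst p) else inv\<^bsub>G\<^esub> f (fst p)) \<otimes>\<^bsub>G\<^esub> y) w \<one>\<^bsub>G\<^esub>"

lemma word_eval_simps [simp]:
  "word_eval G f [] = \<one>\<^bsub>G\<^esub>"
  "word_eval G f (p # w) = (if snd p then f (fst p) else inv\<^bsub>G\<^esub> f (fst p)) \<otimes>\<^bsub>G\<^esub> word_eval G f w"
  by (simp_all add: word_eval_def)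

context group
begin

lemma word_eval_closed [simp]:
  "f \<in> S \<rightarrow> carrier G \<Longrightarrow> w \<in> words S \<Longrightarrow> word_eval G f w \<in> carrier G"
  by (induction w) (auto simp: Pi_iff)

lemma word_eval_append:
  assumes "f \<in> S \<rightarrow> carrier G" "u \<in> words S" "v \<in> words S"
  shows "word_eval G f (u @ v) = word_eval G f u \<otimes> word_eval G f v"
  using assms(2)
proof (induction u)
  case Nil
  then show ?case using assms by simp
next
  case (Cons p u)
  then have "f (fst p) \<in> carrier G" "word_eval G f u \<in> carrier G" "word_eval G f v \<in> carrier G"
    using assms by auto
  with Cons show ?case by (simp add: m_assoc)
qed

lemma word_eval_gen: "f x \<in> carrier G \<Longrightarrow> word_eval G f (gen x) = f x"
  by (simp add: gen_def)

lemma word_eval_word_inv: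
  assumes "f \<in> S \<rightarrow> carrier G" "w \<in> words S"
  shows "word_eval G f (word_inv w) = inv (word_eval G f w)"
  using assms(2)
proof (induction w)
  case Nil
  then show ?case by (simp add: word_inv_def)
next
  case (Cons p w)
  obtain x b where p: "p = (x, b)" by fastforce
  have x: "x \<in> S" "f x \<in> carrier G" and w: "w \<in> words S"
    using Cons.prems assms(1) p by auto
  then have "word_eval G f w \<in> carrier G" using assms by auto
  moreover have "word_inv (p # w) = word_inv w @ [(x, \<not> b)]"
    by (simp add: word_inv_def p)
  moreover have "word_eval G f (word_inv w @ [(x, \<not> b)]) =
      word_eval G f (word_inv w) \<otimes> word_eval G f [(x, \<not> b)]"
    using x w assms(1) by (intro word_eval_append[where S = S]) auto
  ultimately show ?case
    using Cons.IH w x by (auto simp: p inv_mult_group)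
qed

lemma word_eval_word_pow:
  assumes "f \<in> S \<rightarrow> carrier G" "w \<in> words S"
  shows "word_eval G f (word_pow w k) = word_eval G f w [^] k"
proof (induction k)
  case 0
  then show ?case by (simp add: word_pow_def)
next
  case (Suc k)
  have "word_eval G f (word_pow w (Suc k)) = word_eval G f (w @ word_pow w k)"
    by (simp add: word_pow_def)
  also have "\<dots> = word_eval G f w \<otimes> word_eval G f w [^] k"
    using Suc assms word_eval_append[of f S w "word_pow w k"] by simp
  also have "\<dots> = word_eval G f w [^] Suc k"
    using word_eval_closed[OF assms] by (simp add: nat_pow_Suc2[symmetric])
  finally show ?case .
qed

text \<open>Having equal values is itself a congruence containing the cancellations and, by
  \<open>R\<close>, the relations; \<open>pres_eq\<close> is the smallest such congruence.\<close>

lemma word_eval_pres_eq: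
  assumes f: "f \<in> S \<rightarrow> carrier G"
    and R: "\<forall>(l, r) \<in> R. word_eval G f l = word_eval G f r"
    and uv: "pres_eq S R u v"
  shows "word_eval G f u = word_eval G f v"
  using uv
proof (induction rule: pres_eq.induct)
  case (cancel x b)
  then have "f x \<in> carrier G" using f by auto
  then show ?case by simp
next
  case (append u v u' v')
  then show ?case
    using word_eval_append[OF f] pres_eq_words by metis
qed (use R in auto)

text \<open>Von Dyck's theorem, the existence half of the universal property; the uniqueness half is
  \<open>presented_group_hom_eqI\<close>.\<close>

lemma presented_group_hom_exists:
  assumes f: "f \<in> S \<rightarrow> carrier G"
    and R: "\<forall>(l, r) \<in> R. word_eval G f l = word_eval G f r"
  obtains \<phi> where "\<phi> \<in> hom (presented_group S R) G"
    and "\<And>x. x \<in> S \<Longrightarrow> \<phi> (pres_class S R (gen x)) = f x"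
proof -
  \<comment> \<open>Any representative of the class would do: \<open>word_eval_pres_eq\<close> makes
    the value independent of the choice.\<close>
  define \<phi> where "\<phi> c = word_eval G f (SOME w. w \<in> c)" for c
  have \<phi>: "\<phi> (pres_class S R w) = word_eval G f w" if "w \<in> words S" for w
  proof -
    have "w \<in> pres_class S R w"
      using that by (simp add: pres_class_def pres_eq.reflexive)
    then have "(SOME w'. w' \<in> pres_class S R w) \<in> pres_class S R w"
      by (rule someI)
    then have "pres_eq S R w (SOME w'. w' \<in> pres_class S R w)"
      by (simp add: pres_class_def)
    then show ?thesis
      unfolding \<phi>_def using word_eval_pres_eq[OF f R] by metis
  qed
  have "\<phi> \<in> hom (presented_group S R) G"
  proof (rule homI)
    fix x y
    assume "x \<in> carrier (presented_group S R)" "y \<in> carrier (presented_group S R)"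
    then obtain u v where "u \<in> words S" "v \<in> words S"
      "x = pres_class S R u" "y = pres_class S R v"
      by (auto simp: presented_group_def)
    then show "\<phi> (x \<otimes>\<^bsub>presented_group S R\<^esub> y) = \<phi> x \<otimes> \<phi> y"
      using f by (simp add: presented_group_mult \<phi> word_eval_append)
  qed (use f \<phi> in \<open>auto simp: presented_group_def\<close>)
  moreover have "\<phi> (pres_class S R (gen x)) = f x" if "x \<in> S" for x
    using that f \<phi> by (auto simp: word_eval_gen Pi_iff)
  ultimately show ?thesis by (rule that)
qed

end

section \<open>Presented groups: the tautological interpretation, uniqueness, isomorphisms\<close>

lemma word_eval_hom:
  assumes "group_hom G H \<phi>" "f \<in> S \<rightarrow> carrier G" "w \<in> words S"
  shows "\<phi> (word_eval G f w) = word_eval H (\<phi> \<circ> f) w"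
proof -
  interpret group_hom G H \<phi> by fact
  have "f x \<in> carrier G" if "x \<in> S" for x using assms(2) that by auto
  with assms(3) show ?thesis
    by (induction w) (auto simp: G.word_eval_closed[OF assms(2)])
qed

lemma pres_class_closed: "w \<in> words S \<Longrightarrow> pres_class S R w \<in> carrier (presented_group S R)"
  by (simp add: presented_group_def)

text \<open>Only inverse letters need an argument: the cancellation rule makes the class of such a
  letter the inverse of the generator's class. Every class thus becomes a group expression in the
  generators.\<close>

lemma word_eval_pres_class:
  assumes "w \<in> words S"
  shows "word_eval (presented_group S R) (\<lambda>x. pres_class S R (gen x)) w = pres_class S R w"
  using assms
proof (induction w)
  case Nil
  then show ?case by (simp add: presented_group_def)
next
  case (Cons p w)
  let ?P = "presented_group S R"
  interpret P: group ?P by (rule group_presented_group)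
  obtain x b where p: "p = (x, b)" by fastforce
  have x: "x \<in> S" and w: "w \<in> words S" using Cons.prems p by auto
  have "pres_class S R [(x, False)] = inv\<^bsub>?P\<^esub> pres_class S R (gen x)"
  proof (rule P.inv_equality[symmetric])
    have "pres_class S R [(x, False)] \<otimes>\<^bsub>?P\<^esub> pres_class S R (gen x) =
        pres_class S R [(x, False), (x, True)]"
      using x by (simp add: presented_group_mult gen_def)
    also have "\<dots> = pres_class S R []"
      using x pres_eq.cancel[OF x, of R False] by (subst pres_class_eq_iff) auto
    finally show "pres_class S R [(x, False)] \<otimes>\<^bsub>?P\<^esub> pres_class S R (gen x) = \<one>\<^bsub>?P\<^esub>"
      by (simp add: presented_group_def)
  qed (use x in \<open>auto simp: presented_group_def\<close>)
  moreover have "pres_class S R (p # w) = pres_class S R [p] \<otimes>\<^bsub>?P\<^esub> pres_class S R w"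
    using x w p by (simp add: presented_group_mult)
  ultimately show ?case
    using Cons.IH[OF w] by (cases b) (simp_all add: p gen_def)
qed

lemma word_eval_pres_class_relations:
  assumes "R \<subseteq> words S \<times> words S"
  shows "\<forall>(l, r) \<in> R. word_eval (presented_group S R) (\<lambda>x. pres_class S R (gen x)) l =
    word_eval (presented_group S R) (\<lambda>x. pres_class S R (gen x)) r"
proof clarify
  fix l r
  assume lr: "(l, r) \<in> R"
  then have w: "l \<in> words S" "r \<in> words S" using assms by auto
  then have "pres_class S R l = pres_class S R r"
    using lr by (simp add: pres_class_eq_iff pres_eq.relation)
  with w show "word_eval (presented_group S R) (\<lambda>x. pres_class S R (gen x)) l =
      word_eval (presented_group S R) (\<lambda>x. pres_class S R (gen x)) r"
    by (simp add: word_eval_pres_class)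
qed

text \<open>Every element is the value of a word in the generators, and homomorphisms commute with
  evaluation.\<close>

lemma presented_group_hom_eqI:
  assumes "group G"
    and \<phi>: "\<phi> \<in> hom (presented_group S R) G" and \<psi>: "\<psi> \<in> hom (presented_group S R) G"
    and gens: "\<And>x. x \<in> S \<Longrightarrow> \<phi> (pres_class S R (gen x)) = \<psi> (pres_class S R (gen x))"
    and c: "c \<in> carrier (presented_group S R)"
  shows "\<phi> c = \<psi> c"
proof -
  let ?P = "presented_group S R" and ?g = "\<lambda>x. pres_class S R (gen x)"
  obtain w where w: "w \<in> words S" "c = pres_class S R w"
    using c by (auto simp: presented_group_def)
  have g: "?g \<in> S \<rightarrow> carrier ?P" by (simp add: pres_class_closed)
  have hom: "group_hom ?P G \<phi>" "group_hom ?P G \<psi>"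
    using assms group_presented_group by (auto simp: group_hom_def group_hom_axioms_def)
  have "word_eval G (\<phi> \<circ> ?g) w = word_eval G (\<psi> \<circ> ?g) w"
    using w(1) by (induction w) (auto simp: gens)
  then show ?thesis
    using w word_eval_hom[OF hom(1) g w(1)] word_eval_hom[OF hom(2) g w(1)]
    by (simp add: word_eval_pres_class)
qed

text \<open>Both composites agree with the identity on generators, hence everywhere by
  \<open>presented_group_hom_eqI\<close>.\<close>

lemma presented_group_isoI:
  assumes \<phi>: "\<phi> \<in> hom (presented_group S R) (presented_group T Q)"
    and \<psi>: "\<psi> \<in> hom (presented_group T Q) (presented_group S R)"
    and S: "\<And>x. x \<in> S \<Longrightarrow> \<psi> (\<phi> (pres_class S R (gen x))) = pres_class S R (gen x)"
    and T: "\<And>y. y \<in> T \<Longrightarrow> \<phi> (\<psi> (pres_class T Q (gen y))) = pres_class T Q (gen y)"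
  shows "\<phi> \<in> iso (presented_group S R) (presented_group T Q)"
proof -
  have "(\<psi> \<circ> \<phi>) c = (\<lambda>x. x) c" if "c \<in> carrier (presented_group S R)" for c
    by (rule presented_group_hom_eqI[OF group_presented_group hom_compose[OF \<phi> \<psi>]])
      (use S that in \<open>auto simp: hom_def\<close>)
  moreover have "(\<phi> \<circ> \<psi>) c = (\<lambda>x. x) c" if "c \<in> carrier (presented_group T Q)" for c
    by (rule presented_group_hom_eqI[OF group_presented_group hom_compose[OF \<psi> \<phi>]])
      (use T that in \<open>auto simp: hom_def\<close>)
  ultimately have "bij_betw \<phi> (carrier (presented_group S R)) (carrier (presented_group T Q))"
    using hom_in_carrier[OF \<phi>] hom_in_carrier[OF \<psi>]
    by (intro bij_betwI[where g = \<psi>]) auto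
  with \<phi> show ?thesis by (simp add: iso_def)
qed


section \<open>Conjugation sequences\<close>

text \<open>The same right-nested \<open>foldr\<close> as in \<open>sphere_delta\<close>, so that
  \<delta> is a \<open>list_mult\<close> by unfolding alone.\<close>

definition list_mult :: "('g, 'm) monoid_scheme \<Rightarrow> 'g list \<Rightarrow> 'g" where
  "list_mult G xs = foldr (\<lambda>x y. x \<otimes>\<^bsub>G\<^esub> y) xs \<one>\<^bsub>G\<^esub>"

lemma list_mult_simps [simp]:
  "list_mult G [] = \<one>\<^bsub>G\<^esub>"
  "list_mult G (x # xs) = x \<otimes>\<^bsub>G\<^esub> list_mult G xs"
  by (simp_all add: list_mult_def)

lemma upt_split: "i \<le> j \<Longrightarrow> j \<le> k \<Longrightarrow> [i..<k] = [i..<j] @ [j..<k]"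
  using upt_add_eq_append[of i j "k - j"] by simp

context group
begin

lemma list_mult_closed [simp]: "set xs \<subseteq> carrier G \<Longrightarrow> list_mult G xs \<in> carrier G"
  by (induction xs) auto

lemma list_mult_append:
  "set xs \<subseteq> carrier G \<Longrightarrow> set ys \<subseteq> carrier G \<Longrightarrow>
    list_mult G (xs @ ys) = list_mult G xs \<otimes> list_mult G ys"
  by (induction xs) (auto simp: m_assoc)

lemma list_mult_commute:
  assumes "z \<in> carrier G" "set xs \<subseteq> carrier G" "\<And>x. x \<in> set xs \<Longrightarrow> z \<otimes> x = x \<otimes> z"
  shows "z \<otimes> list_mult G xs = list_mult G xs \<otimes> z"
  using assms(2,3)
proof (induction xs)
  case (Cons x xs)
  then have c: "x \<in> carrier G" "list_mult G xs \<in> carrier G" by auto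
  have "z \<otimes> (x \<otimes> list_mult G xs) = x \<otimes> (z \<otimes> list_mult G xs)"
    using Cons.prems(2)[of x] c assms(1) by (simp flip: m_assoc)
  with Cons c assms(1) show ?case by (simp add: m_assoc)
qed (use assms in simp)

lemma word_eval_concat_gen:
  "f \<in> S \<rightarrow> carrier G \<Longrightarrow> set xs \<subseteq> S \<Longrightarrow>
    word_eval G f (concat (map gen xs)) = list_mult G (map f xs)"
  by (induction xs) (auto simp: gen_def)

text \<open>Both \<open>x' \<otimes> y' \<otimes> d\<close> and
  \<open>y' \<otimes> x' \<otimes> d\<close> become \<open>d\<close> times a product of
  \<open>x\<close> and \<open>y\<close>, and \<open>d\<close> cancels. Commutation is transported in
  this way along conjugation by \<open>d\<close> without writing inverses.\<close>

lemma intertwine_commute: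
  assumes c: "d \<in> carrier G" "x \<in> carrier G" "y \<in> carrier G" "x' \<in> carrier G" "y' \<in> carrier G"
    and "d \<otimes> x = x' \<otimes> d" "d \<otimes> y = y' \<otimes> d" "x \<otimes> y = y \<otimes> x"
  shows "x' \<otimes> y' = y' \<otimes> x'"
proof -
  have "x' \<otimes> y' \<otimes> d = x' \<otimes> d \<otimes> y" "y' \<otimes> x' \<otimes> d = y' \<otimes> d \<otimes> x"
    using assms by (simp_all add: m_assoc)
  then have "x' \<otimes> y' \<otimes> d = d \<otimes> (x \<otimes> y)" "y' \<otimes> x' \<otimes> d = d \<otimes> (y \<otimes> x)"
    using assms by (metis m_assoc)+
  then have "x' \<otimes> y' \<otimes> d = y' \<otimes> x' \<otimes> d" using assms by simp
  then show ?thesis using c by simp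
qed

end

text \<open>The bound \<open>N\<close> lets one locale serve both groups: N = n - 1 for the sphere
  generators, which stop there, and any \<open>N\<close> for the conjugates of \<open>a\<close>,
  which are defined at all indices.\<close>

locale conj_sequence = group G for G (structure) +
  fixes s :: "nat \<Rightarrow> 'a" and d :: 'a and N :: nat
  assumes s_closed: "\<And>i. 1 \<le> i \<Longrightarrow> i \<le> N \<Longrightarrow> s i \<in> carrier G"
    and d_closed [simp]: "d \<in> carrier G"
    and shift: "\<And>i. 1 \<le> i \<Longrightarrow> i < N \<Longrightarrow> d \<otimes> s i = s (Suc i) \<otimes> d"
begin

lemma shift_pow:
  assumes "1 \<le> i" "i + k \<le> N"
  shows "d [^] k \<otimes> s i = s (i + k) \<otimes> d [^] k"
  using assms(2)
proof (induction k)
  case 0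
  then show ?case using assms s_closed[of i] by simp
next
  case (Suc k)
  have c: "s i \<in> carrier G" "s (i + k) \<in> carrier G" "s (i + Suc k) \<in> carrier G"
    using assms Suc.prems s_closed by auto
  have "d [^] Suc k \<otimes> s i = d \<otimes> (d [^] k \<otimes> s i)"
    using c unfolding nat_pow_Suc2[OF d_closed] by (simp add: m_assoc)
  also have "\<dots> = d \<otimes> s (i + k) \<otimes> d [^] k"
    using c Suc by (simp add: m_assoc)
  also have "d \<otimes> s (i + k) = s (i + Suc k) \<otimes> d"
    using shift[of "i + k"] Suc.prems assms by simp
  also have "s (i + Suc k) \<otimes> d \<otimes> d [^] k = s (i + Suc k) \<otimes> d [^] Suc k"
    using c unfolding nat_pow_Suc2[OF d_closed] by (simp add: m_assoc)
  finally show ?case .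
qed

lemma conj_pow:
  assumes "1 \<le> i" "i + k \<le> N"
  shows "d [^] k \<otimes> s i \<otimes> inv (d [^] k) = s (i + k)"
  using shift_pow[OF assms] s_closed[of "i + k"] assms by (simp add: m_assoc)

text \<open>Each further factor \<open>d \<otimes> s 1\<close> places \<open>s 1\<close> behind
  \<open>d [^] Suc k\<close>; moved to the front of that power it becomes
  \<open>s (k + 2)\<close>.\<close>

lemma pow_mult_first:
  assumes "Suc k \<le> N"
  shows "(d \<otimes> s 1) [^] k = list_mult G (map s [2..<k + 2]) \<otimes> d [^] k"
  using assms
proof (induction k)
  case 0
  then show ?case by simp
next
  case (Suc k)
  let ?P = "list_mult G (map s [2..<k + 2])"
  have c: "s 1 \<in> carrier G" "s (k + 2) \<in> carrier G" "set (map s [2..<k + 2]) \<subseteq> carrier G"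
    using Suc.prems s_closed by auto
  then have P: "?P \<in> carrier G" by (intro list_mult_closed)
  have sh: "d [^] Suc k \<otimes> s 1 = s (k + 2) \<otimes> d [^] Suc k"
    using shift_pow[of 1 "Suc k"] Suc.prems by simp
  have "(d \<otimes> s 1) [^] Suc k = ?P \<otimes> d [^] k \<otimes> (d \<otimes> s 1)"
    using Suc by simp
  also have "\<dots> = ?P \<otimes> (d [^] Suc k \<otimes> s 1)"
    using c P by (simp add: m_assoc)
  also have "\<dots> = ?P \<otimes> s (k + 2) \<otimes> d [^] Suc k"
    unfolding sh using c P by (simp only: m_assoc nat_pow_closed d_closed)
  also have "?P \<otimes> s (k + 2) = list_mult G (map s [2..<Suc k + 2])"
    using c list_mult_append[of "map s [2..<k + 2]" "[s (k + 2)]"] by simp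
  finally show ?case .
qed

text \<open>The leftmost factor \<open>s (Suc k)\<close> is written as d^k s_1 d^-k. Its trailing
  d^-k, with one more inverse from the conjugation, meets the d^k of the induction hypothesis and
  leaves a single \<open>inv d\<close>.\<close>

lemma conj_rev_product:
  assumes "k \<le> N"
  shows "d \<otimes> list_mult G (map s (rev [1..<Suc k])) \<otimes> inv d = d [^] k \<otimes> (s 1 \<otimes> inv d) [^] k"
  using assms
proof (induction k)
  case 0
  then show ?case by simp
next
  case (Suc k)
  let ?R = "list_mult G (map s (rev [1..<Suc k]))" and ?X = "(s 1 \<otimes> inv d) [^] k"
  have c: "s 1 \<in> carrier G" "s (Suc k) \<in> carrier G"
    using Suc.prems s_closed by auto
  have R: "?R \<in> carrier G"
    using Suc.prems s_closed by (intro list_mult_closed) auto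
  have X: "?X \<in> carrier G" using c by simp
  have "d \<otimes> list_mult G (map s (rev [1..<Suc (Suc k)])) \<otimes> inv d = d \<otimes> (s (Suc k) \<otimes> ?R) \<otimes> inv d"
    by simp
  also have "\<dots> = d \<otimes> s (Suc k) \<otimes> inv d \<otimes> (d \<otimes> ?R \<otimes> inv d)"
    using c R by (simp add: m_assoc inv_solve_left)
  also have "\<dots> = d \<otimes> s (Suc k) \<otimes> inv d \<otimes> (d [^] k \<otimes> ?X)"
    using Suc by simp
  also have "s (Suc k) = d [^] k \<otimes> s 1 \<otimes> inv (d [^] k)"
    using conj_pow[of 1 k] Suc.prems by simp
  also have "d \<otimes> (d [^] k \<otimes> s 1 \<otimes> inv (d [^] k)) \<otimes> inv d \<otimes> (d [^] k \<otimes> ?X) =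
      d \<otimes> d [^] k \<otimes> s 1 \<otimes> (inv (d \<otimes> d [^] k) \<otimes> d [^] k) \<otimes> ?X"
    using c X by (simp add: m_assoc inv_mult_group)
  also have "inv (d \<otimes> d [^] k) \<otimes> d [^] k = inv d"
    by (simp add: nat_pow_Suc2[symmetric] inv_mult_group m_assoc)
  also have "d \<otimes> d [^] k \<otimes> s 1 \<otimes> inv d \<otimes> ?X = d [^] Suc k \<otimes> (s 1 \<otimes> inv d) [^] Suc k"
    using c nat_pow_Suc2[of "s 1 \<otimes> inv d" k] unfolding nat_pow_Suc2[OF d_closed]
    by (simp add: m_assoc)
  finally show ?case .
qed

text \<open>By \<open>conj_rev_product\<close> the element on the right is the conjugate by
  \<open>d\<close> of the one on the left. With N = n - 1 this matches the last sphere relation with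
  the last two-generator relation.\<close>

lemma full_twist_iff:
  assumes N: "1 \<le> N"
  shows "d \<otimes> list_mult G (map s (rev [1..<Suc N])) = \<one> \<longleftrightarrow> d [^] Suc N \<otimes> (s 1 \<otimes> inv d) [^] N = \<one>"
proof -
  let ?R = "list_mult G (map s (rev [1..<Suc N]))" and ?X = "(s 1 \<otimes> inv d) [^] N"
  have R: "?R \<in> carrier G"
    using s_closed by (intro list_mult_closed) auto
  have X: "?X \<in> carrier G" using s_closed[of 1] N by simp
  have "d [^] Suc N \<otimes> ?X = d \<otimes> (d [^] N \<otimes> ?X)"
    using X unfolding nat_pow_Suc2[OF d_closed] by (simp add: m_assoc)
  also have "\<dots> = d \<otimes> (d \<otimes> ?R) \<otimes> inv d"
    using conj_rev_product[of N] R by (simp add: m_assoc)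
  finally have eq: "d [^] Suc N \<otimes> ?X = d \<otimes> (d \<otimes> ?R) \<otimes> inv d" .
  have "x \<otimes> inv d = \<one> \<longleftrightarrow> x = d" if "x \<in> carrier G" for x
    using that inv_solve_right'[of \<one> x d] by (simp add: eq_commute)
  then have "d \<otimes> (d \<otimes> ?R) \<otimes> inv d = \<one> \<longleftrightarrow> d \<otimes> (d \<otimes> ?R) = d"
    using R by simp
  also have "\<dots> \<longleftrightarrow> d \<otimes> ?R = \<one>"
    using R l_cancel[of d "d \<otimes> ?R" \<one>] by simp
  finally show ?thesis using eq by simp
qed

end

section \<open>Braid relations and conjugation sequences\<close>

context group
begin

text \<open>Split the product as A s_i s_(i+1) B. Then \<open>s i\<close> commutes with
  \<open>?B\<close>, \<open>s (i + 1)\<close> commutes with \<open>?A\<close>, and the braid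
  relation rewrites what meets in the middle.\<close>

lemma braid_product_shift:
  assumes closed: "\<And>i. 1 \<le> i \<Longrightarrow> i < n \<Longrightarrow> s i \<in> carrier G"
    and comm: "\<And>i j. 1 \<le> i \<Longrightarrow> i + 2 \<le> j \<Longrightarrow> j < n \<Longrightarrow> s i \<otimes> s j = s j \<otimes> s i"
    and braid: "\<And>i. 1 \<le> i \<Longrightarrow> i + 1 < n \<Longrightarrow>
      s i \<otimes> s (i + 1) \<otimes> s i = s (i + 1) \<otimes> s i \<otimes> s (i + 1)"
    and i: "1 \<le> i" "i + 1 < n"
  shows "list_mult G (map s [1..<n]) \<otimes> s i = s (i + 1) \<otimes> list_mult G (map s [1..<n])"
proof -
  let ?A = "list_mult G (map s [1..<i])" and ?B = "list_mult G (map s [i + 2..<n])"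
  have c: "s i \<in> carrier G" "s (i + 1) \<in> carrier G"
    "set (map s [1..<i]) \<subseteq> carrier G" "set (map s [i + 2..<n]) \<subseteq> carrier G"
    using i closed by auto
  then have AB: "?A \<in> carrier G" "?B \<in> carrier G" by (simp_all only: list_mult_closed)
  have "[1..<n] = [1..<i] @ i # (i + 1) # [i + 2..<n]"
    using i upt_split[of 1 i n] by (simp add: upt_conv_Cons)
  then have D: "list_mult G (map s [1..<n]) = ?A \<otimes> (s i \<otimes> (s (i + 1) \<otimes> ?B))"
    using c list_mult_append[of "map s [1..<i]" "map s (i # (i + 1) # [i + 2..<n])"] by simp
  have A: "s (i + 1) \<otimes> ?A = ?A \<otimes> s (i + 1)"
    using c i comm by (intro list_mult_commute) (auto intro: comm[symmetric])
  have B: "s i \<otimes> ?B = ?B \<otimes> s i"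
    using c i comm by (intro list_mult_commute) auto
  have "?A \<otimes> (s i \<otimes> (s (i + 1) \<otimes> ?B)) \<otimes> s i = ?A \<otimes> (s i \<otimes> s (i + 1) \<otimes> s i) \<otimes> ?B"
    using c AB B by (simp add: m_assoc)
  also have "\<dots> = ?A \<otimes> s (i + 1) \<otimes> (s i \<otimes> (s (i + 1) \<otimes> ?B))"
    unfolding braid[OF i] using c AB by (simp add: m_assoc)
  also have "\<dots> = s (i + 1) \<otimes> (?A \<otimes> (s i \<otimes> (s (i + 1) \<otimes> ?B)))"
    unfolding A[symmetric] using c AB by (simp add: m_assoc)
  finally show ?thesis unfolding D .
qed

end

text \<open>Collects the first two families of relations, which yield the commutation and braid
  relations; the third is handled by \<open>full_twist_iff\<close>. The bound
  \<open>2 * i \<le> n\<close> is i \<le> n/2 over the naturals.\<close>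

locale two_generator_braid = group G for G (structure) +
  fixes n :: nat and a d :: 'a
  assumes n_ge_2: "2 \<le> n"
    and a_closed [simp]: "a \<in> carrier G" and d_closed [simp]: "d \<in> carrier G"
    and far_commute: "\<And>i. 2 \<le> i \<Longrightarrow> 2 * i \<le> n \<Longrightarrow>
      a \<otimes> (d [^] i \<otimes> a \<otimes> inv (d [^] i)) = d [^] i \<otimes> a \<otimes> inv (d [^] i) \<otimes> a"
    and pow_n: "d [^] n = (d \<otimes> a) [^] (n - 1)"
begin

text \<open>The candidate for \<delta>_i. Indices beyond n - 1 are kept because periodicity and the
  product s_2 ... s_n refer to them.\<close>

definition s :: "nat \<Rightarrow> 'a" where
  "s i = d [^] (i - 1) \<otimes> a \<otimes> inv (d [^] (i - 1))"

lemma s_in_carrier [simp]: "s i \<in> carrier G"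
  by (simp add: s_def)

lemma s_1 [simp]: "s 1 = a" "s (Suc 0) = a"
  by (simp_all add: s_def)

lemma conj_sequence_s: "conj_sequence G s d N"
proof
  fix i :: nat
  assume "1 \<le> i" "i < N"
  then obtain k where i: "i = Suc k" by (cases i) auto
  show "d \<otimes> s i = s (Suc i) \<otimes> d"
    unfolding s_def i diff_Suc_1 nat_pow_Suc2[OF d_closed]
    by (simp add: m_assoc inv_mult_group)
qed auto

lemma s_shift: "1 \<le> i \<Longrightarrow> d \<otimes> s i = s (Suc i) \<otimes> d"
  using conj_sequence.shift[OF conj_sequence_s[of "Suc i"]] by simp

lemma pow_n_central: "d [^] n \<otimes> a = a \<otimes> d [^] n"
proof -
  \<comment> \<open>Chaining the recursions x^k x = x^(k+1) = x x^k shows that a power commutes with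
    its base; by \<open>pow_n\<close> the base may be d a.\<close>
  have "d [^] n \<otimes> (d \<otimes> a) = d \<otimes> a \<otimes> d [^] n"
    unfolding pow_n by (rule trans[OF nat_pow_Suc[symmetric] nat_pow_Suc2]) simp
  moreover have "d [^] n \<otimes> (d \<otimes> a) = d \<otimes> (d [^] n \<otimes> a)"
  proof -
    have "d [^] n \<otimes> d = d \<otimes> d [^] n"
      by (rule trans[OF nat_pow_Suc[symmetric] nat_pow_Suc2]) simp
    then show ?thesis by (simp flip: m_assoc)
  qed
  ultimately show ?thesis by (simp add: m_assoc)
qed

lemma s_periodic: "s (Suc n) = a"
  by (simp add: s_def pow_n_central m_assoc)

lemma s_far_commute:
  assumes "1 \<le> i" "2 \<le> k" "k + 2 \<le> n"
  shows "s i \<otimes> s (i + k) = s (i + k) \<otimes> s i"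
proof -
  \<comment> \<open>Reduces everything to pairs starting at index 1: conjugation by \<open>d\<close>
    carries a commuting pair one index up.\<close>
  have shift_all: "s (i + m) \<otimes> s (j + m) = s (j + m) \<otimes> s (i + m)"
    if "1 \<le> i" "1 \<le> j" "s i \<otimes> s j = s j \<otimes> s i" for i j m
    using that
  proof (induction m)
    case (Suc m)
    have sh: "d \<otimes> s (i + m) = s (i + Suc m) \<otimes> d" "d \<otimes> s (j + m) = s (j + Suc m) \<otimes> d"
      unfolding add_Suc_right by (rule s_shift[OF trans_le_add1[OF that(1)]],
        rule s_shift[OF trans_le_add1[OF that(2)]])
    show ?case
      by (rule intertwine_commute[OF d_closed s_in_carrier s_in_carrier s_in_carrier s_in_carrier
        sh Suc.IH[OF that]])
  qed (simp only: add_0_right that(3))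
  have half: "s 1 \<otimes> s (1 + k) = s (1 + k) \<otimes> s 1" if "2 \<le> k" "2 * k \<le> n" for k
    using far_commute[OF that] by (simp add: s_def)
  have "s 1 \<otimes> s (1 + k) = s (1 + k) \<otimes> s 1"
  proof (cases "2 * k \<le> n")
    case True
    with half assms show ?thesis by blast
  next
    case False
    \<comment> \<open>The distance n - k now lies between 2 and n/2. Translating the pair 1, 1 + (n
      - k) by k gives 1 + k, n + 1, and periodicity turns the second member into
      \<open>s 1\<close>.\<close>
    have "s 1 \<otimes> s (1 + (n - k)) = s (1 + (n - k)) \<otimes> s 1"
      using half[of "n - k"] False assms by simp
    from shift_all[OF _ _ this, of k] show ?thesis
      using assms by (simp add: s_periodic)
  qed
  from shift_all[OF _ _ this, of "i - 1"] assms(1) show ?thesis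
    by (simp add: add.commute)
qed

text \<open>Comparing \<open>pow_n\<close> with \<open>pow_mult_first\<close> yields d = s_2 ...
  s_n. Shifting all indices then gives d (s_1 ... s_(n-1)) = (s_2 ... s_n) d = d d, and
  \<open>d\<close> cancels.\<close>

lemma product_s: "list_mult G (map s [1..<n]) = d"
proof -
  let ?P = "list_mult G (map s [1..<n])" and ?Q = "list_mult G (map s [2..<Suc n])"
  have PQ: "?P \<in> carrier G" "?Q \<in> carrier G" by (auto intro!: list_mult_closed)
  have "d \<otimes> d [^] (n - 1) = d [^] n"
    using n_ge_2 nat_pow_Suc2[of d "n - 1"] by simp
  also have "\<dots> = ?Q \<otimes> d [^] (n - 1)"
    using conj_sequence.pow_mult_first[OF conj_sequence_s[of n], of "n - 1"] n_ge_2 pow_n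
    by (simp add: Suc_diff_Suc numeral_2_eq_2)
  finally have Q: "?Q = d" using PQ by simp
  have "d \<otimes> list_mult G (map s xs) = list_mult G (map s (map Suc xs)) \<otimes> d"
    if "\<forall>i\<in>set xs. 1 \<le> i" for xs
    using that
  proof (induction xs)
    case (Cons i xs)
    have c: "list_mult G (map s xs) \<in> carrier G" "list_mult G (map s (map Suc xs)) \<in> carrier G"
      by (auto intro!: list_mult_closed)
    have "d \<otimes> (s i \<otimes> list_mult G (map s xs)) = s (Suc i) \<otimes> (d \<otimes> list_mult G (map s xs))"
      using c s_shift[of i] Cons.prems by (simp flip: m_assoc)
    with Cons c show ?case by (simp add: m_assoc)
  qed simp
  from this[of "[1..<n]"] have "d \<otimes> ?P = ?Q \<otimes> d"
    by (simp only: map_Suc_upt) (simp add: numeral_2_eq_2)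
  then show ?thesis using Q PQ by simp
qed

text \<open>The case i = 1 comes from the product formula for \<open>d\<close>; each further case is
  the previous one conjugated by \<open>d\<close>. The bound 3 \<le> n makes s_2 occur in the
  product.\<close>

lemma s_braid:
  assumes "3 \<le> n" "1 \<le> i"
  shows "s i \<otimes> s (Suc i) \<otimes> s i = s (Suc i) \<otimes> s i \<otimes> s (Suc i)"
  using assms(2)
proof (induction i rule: dec_induct)
  case base
  let ?C = "list_mult G (map s [3..<n])"
  have C: "?C \<in> carrier G" by (auto intro!: list_mult_closed)
  have aC: "a \<otimes> ?C = ?C \<otimes> a"
  proof (rule list_mult_commute)
    fix x
    assume "x \<in> set (map s [3..<n])"
    then obtain j where "x = s j" "3 \<le> j" "j < n" by auto
    then show "a \<otimes> x = x \<otimes> a"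
      using s_far_commute[of 1 "j - 1"] by simp
  qed auto
  have "[1..<n] = 1 # 2 # [3..<n]"
    using assms(1) by (simp add: upt_conv_Cons numeral_3_eq_3 numeral_2_eq_2)
  then have d: "d = a \<otimes> (s 2 \<otimes> ?C)" using product_s by simp
  \<comment> \<open>This is \<open>d \<otimes> a = s 2 \<otimes> d\<close> with \<open>d\<close>
    expanded. Next, \<open>a\<close> moves left past \<open>?C\<close>, and \<open>?C\<close>
    cancels.\<close>
  have "a \<otimes> (s 2 \<otimes> ?C) \<otimes> a = s 2 \<otimes> (a \<otimes> (s 2 \<otimes> ?C))"
    using s_shift[of 1] by (simp add: numeral_2_eq_2 flip: d[unfolded numeral_2_eq_2])
  then have "a \<otimes> s 2 \<otimes> a \<otimes> ?C = s 2 \<otimes> a \<otimes> s 2 \<otimes> ?C"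
    using C aC by (simp add: m_assoc)
  then show ?case using C by (simp add: numeral_2_eq_2)
next
  case (step i)
  let ?x = "s i" and ?y = "s (Suc i)" and ?z = "s (Suc (Suc i))"
  have x: "d \<otimes> ?x = ?y \<otimes> d" and y: "d \<otimes> ?y = ?z \<otimes> d"
    using step s_shift by auto
  have move: "d \<otimes> (u \<otimes> v \<otimes> w) = u' \<otimes> v' \<otimes> w' \<otimes> d"
    if "d \<otimes> u = u' \<otimes> d" "d \<otimes> v = v' \<otimes> d" "d \<otimes> w = w' \<otimes> d"
      "u \<in> carrier G" "v \<in> carrier G" "w \<in> carrier G"
      "u' \<in> carrier G" "v' \<in> carrier G" "w' \<in> carrier G" for u v w u' v' w'
  proof -
    have "d \<otimes> (u \<otimes> v \<otimes> w) = d \<otimes> u \<otimes> v \<otimes> w" using that(4-) by (simp add: m_assoc)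
    also have "\<dots> = u' \<otimes> (d \<otimes> v) \<otimes> w" using that(4-) unfolding that(1) by (simp add: m_assoc)
    also have "\<dots> = u' \<otimes> v' \<otimes> (d \<otimes> w)" using that(4-) unfolding that(2) by (simp add: m_assoc)
    also have "\<dots> = u' \<otimes> v' \<otimes> w' \<otimes> d" using that(4-) unfolding that(3) by (simp add: m_assoc)
    finally show ?thesis .
  qed
  have "?y \<otimes> ?z \<otimes> ?y \<otimes> d = ?z \<otimes> ?y \<otimes> ?z \<otimes> d"
    using move[OF x y x] move[OF y x y] step.IH by simp
  then show ?case by simp
qed

end

section \<open>Evaluating the relations\<close>

text \<open>The bridge between relations of words and equations in \<open>G\<close>, used in both
  directions. Commutation is asked only for i + 2 \<le> j, since the equation is symmetric in the
  two indices.\<close>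

lemma (in group) sphere_rels_hold_iff:
  assumes n: "n \<ge> 2" and f: "f \<in> sphere_gens n \<rightarrow> carrier G"
  shows "(\<forall>(l, r) \<in> sphere_rels n. word_eval G f l = word_eval G f r) \<longleftrightarrow>
    (\<forall>i j. 1 \<le> i \<and> i + 2 \<le> j \<and> j < n \<longrightarrow> f i \<otimes> f j = f j \<otimes> f i) \<and>
    (\<forall>i. 1 \<le> i \<and> i + 1 < n \<longrightarrow> f i \<otimes> f (i + 1) \<otimes> f i = f (i + 1) \<otimes> f i \<otimes> f (i + 1)) \<and>
    list_mult G (map f [1..<n]) \<otimes> list_mult G (map f (rev [1..<n])) = \<one>"
    (is "?L \<longleftrightarrow> ?comm \<and> ?braid \<and> ?sphere")
proof -
  have c: "f i \<in> carrier G" if "1 \<le> i" "i < n" for i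
    using f that by (auto simp: sphere_gens_def)
  note app = word_eval_append[OF f]
  have g: "gen i \<in> words (sphere_gens n)" "word_eval G f (gen i) = f i" if "1 \<le> i" "i < n" for i
    using that c by (auto simp: sphere_gens_def word_eval_gen)
  have app2: "word_eval G f (gen i @ gen j) = f i \<otimes> f j" if "1 \<le> i" "i < n" "1 \<le> j" "j < n" for i j
    using that by (simp only: app g)
  define w where "w = concat (map gen [1..<n - 1]) @ word_pow (gen (n - 1)) 2 @
    concat (map gen (rev [1..<n - 1]))"
  have upt: "[1..<n] = [1..<n - 1] @ [n - 1]"
    using n upt_split[of 1 "n - 1" n] by (simp add: upt_conv_Cons)
  \<comment> \<open>The square of the last generator is shared out: one copy ends
    \<open>[1..<n]\<close>, the other begins its reverse.\<close>
  have "w = concat (map gen ([1..<n] @ rev [1..<n]))"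
    unfolding w_def upt by (simp add: word_pow_def numeral_2_eq_2)
  then have "word_eval G f w = list_mult G (map f ([1..<n] @ rev [1..<n]))"
    using f by (simp only: word_eval_concat_gen[of f "sphere_gens n"])
      (subst word_eval_concat_gen[of f "sphere_gens n"], auto simp: sphere_gens_def)
  also have "\<dots> = list_mult G (map f [1..<n]) \<otimes> list_mult G (map f (rev [1..<n]))"
    unfolding map_append using c by (intro list_mult_append) auto
  finally have w: "word_eval G f w = \<dots>" .
  have ball: "(\<forall>(l, r) \<in> {(K i j, L i j) | i j. P i j} \<union> {(M i, N i) | i. Q i} \<union> {(x, y)}. F l = F r) \<longleftrightarrow>
      (\<forall>i j. P i j \<longrightarrow> F (K i j) = F (L i j)) \<and> (\<forall>i. Q i \<longrightarrow> F (M i) = F (N i)) \<and> F x = F y"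
    for K L :: "nat \<Rightarrow> nat \<Rightarrow> nat word" and M N :: "nat \<Rightarrow> nat word" and P Q x y
      and F :: "nat word \<Rightarrow> 'a"
    by blast
  have "?L \<longleftrightarrow>
      (\<forall>i j. i \<in> {1..n - 1} \<and> j \<in> {1..n - 1} \<and> \<bar>int i - int j\<bar> > 1 \<longrightarrow>
        word_eval G f (gen i @ gen j) = word_eval G f (gen j @ gen i)) \<and>
      (\<forall>i. 1 \<le> i \<and> i \<le> n - 2 \<longrightarrow> word_eval G f (gen i @ gen (i + 1) @ gen i) =
        word_eval G f (gen (i + 1) @ gen i @ gen (i + 1))) \<and> ?sphere"
    unfolding sphere_rels_def w_def[symmetric] ball w word_eval_simps ..
  also have "(\<forall>i j. i \<in> {1..n - 1} \<and> j \<in> {1..n - 1} \<and> \<bar>int i - int j\<bar> > 1 \<longrightarrow>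
        word_eval G f (gen i @ gen j) = word_eval G f (gen j @ gen i)) \<longleftrightarrow> ?comm"
    (is "?l \<longleftrightarrow> _")
  proof
    assume l: ?l
    show ?comm
    proof (intro allI impI)
      fix i j
      assume "1 \<le> i \<and> i + 2 \<le> j \<and> j < n"
      moreover from this have "i \<in> {1..n - 1} \<and> j \<in> {1..n - 1} \<and> \<bar>int i - int j\<bar> > 1"
        by auto
      ultimately show "f i \<otimes> f j = f j \<otimes> f i"
        using l[rule_format, of i j] by (auto simp: app2)
    qed
  next
    assume r: ?comm
    show ?l
    proof (intro allI impI)
      fix i j
      assume ij: "i \<in> {1..n - 1} \<and> j \<in> {1..n - 1} \<and> \<bar>int i - int j\<bar> > 1"
      have "f i \<otimes> f j = f j \<otimes> f i"
        using r[rule_format, of i j] r[rule_format, of j i] ij by (cases "i < j") auto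
      with ij show "word_eval G f (gen i @ gen j) = word_eval G f (gen j @ gen i)"
        by (auto simp: app2)
    qed
  qed
  also have "(\<forall>i. 1 \<le> i \<and> i \<le> n - 2 \<longrightarrow> word_eval G f (gen i @ gen (i + 1) @ gen i) =
        word_eval G f (gen (i + 1) @ gen i @ gen (i + 1))) \<longleftrightarrow> ?braid"
  proof -
    have "word_eval G f (gen i @ gen (i + 1) @ gen i) = f i \<otimes> f (i + 1) \<otimes> f i"
      "word_eval G f (gen (i + 1) @ gen i @ gen (i + 1)) = f (i + 1) \<otimes> f i \<otimes> f (i + 1)"
      if "1 \<le> i" "i + 1 < n" for i
      using that c[of i] c[of "i + 1"] g[of i] g[of "i + 1"]
      by (simp_all add: app m_assoc del: words_simps(4))
    moreover have "i \<le> n - 2 \<longleftrightarrow> i + 1 < n" for i using n by auto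
    ultimately show ?thesis by metis
  qed
  finally show ?thesis .
qed

lemma (in group) two_gen_rels_hold_iff:
  fixes a d
  assumes f: "f \<in> {Delta1, Delta} \<rightarrow> carrier G"
  defines "a \<equiv> f Delta1" and "d \<equiv> f Delta"
  shows "(\<forall>(l, r) \<in> two_gen_rels n. word_eval G f l = word_eval G f r) \<longleftrightarrow>
    (\<forall>i. 2 \<le> i \<and> 2 * i \<le> n \<longrightarrow>
      a \<otimes> (d [^] i \<otimes> a \<otimes> inv (d [^] i)) = d [^] i \<otimes> a \<otimes> inv (d [^] i) \<otimes> a) \<and>
    d [^] n = (d \<otimes> a) [^] (n - 1) \<and>
    d [^] n \<otimes> (a \<otimes> inv d) [^] (n - 1) = \<one>"
proof -
  have [simp]: "a \<in> carrier G" "d \<in> carrier G"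
    using f by (auto simp: a_def d_def)
  have [simp]: "word_eval G f (gen Delta1) = a" "word_eval G f (gen Delta) = d"
    using f by (auto simp: word_eval_gen a_def d_def)
  have half: "real i \<le> real n / 2 \<longleftrightarrow> 2 * i \<le> n" for i by linarith
  note ev = word_eval_append[OF f] word_eval_word_pow[OF f] word_eval_word_inv[OF f]
  have "word_eval G f (gen Delta1 @ word_pow (gen Delta) i @ gen Delta1 @
        word_inv (word_pow (gen Delta) i)) = a \<otimes> (d [^] i \<otimes> a \<otimes> inv (d [^] i))"
    "word_eval G f (word_pow (gen Delta) i @ gen Delta1 @ word_inv (word_pow (gen Delta) i) @
        gen Delta1) = d [^] i \<otimes> a \<otimes> inv (d [^] i) \<otimes> a" for i
    by (simp_all add: ev m_assoc)
  note rel1 = this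
  have rel23: "word_eval G f (word_pow (gen Delta) n) = d [^] n"
    "word_eval G f (word_pow (gen Delta @ gen Delta1) (n - 1)) = (d \<otimes> a) [^] (n - 1)"
    "word_eval G f (word_pow (gen Delta) n @ word_pow (gen Delta1 @ word_inv (gen Delta)) (n - 1)) =
      d [^] n \<otimes> (a \<otimes> inv d) [^] (n - 1)"
    by (simp_all add: ev)
  have "(\<forall>(l, r) \<in> {(L i, R i) | i. P i} \<union> {(x, y)} \<union> {(z, z')}. F l = F r) \<longleftrightarrow>
      (\<forall>i. P i \<longrightarrow> F (L i) = F (R i)) \<and> F x = F y \<and> F z = F z'"
    for L R :: "nat \<Rightarrow> two_gen word" and P x y z z' and F :: "two_gen word \<Rightarrow> 'a"
    by auto
  then show ?thesis
    unfolding two_gen_rels_def half by (simp only: rel1 rel23 word_eval_simps)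
qed


section \<open>The two-generator presentation\<close>

text \<open>Here \<open>g i\<close> is the intended image of \<delta>_i. The last claim recovers
  \<open>f Delta\<close> from the \<open>g i\<close>; it later shows that one composite fixes the
  generators.\<close>

lemma (in group) sphere_rels_hold_of_two_gen_rels:
  fixes a d
  assumes n: "n \<ge> 2" and f: "f \<in> {Delta1, Delta} \<rightarrow> carrier G"
    and rels: "\<forall>(l, r) \<in> two_gen_rels n. word_eval G f l = word_eval G f r"
  defines "g \<equiv> \<lambda>i. f Delta [^] (i - 1) \<otimes> f Delta1 \<otimes> inv (f Delta [^] (i - 1))"
  shows "g \<in> sphere_gens n \<rightarrow> carrier G"
    and "\<forall>(l, r) \<in> sphere_rels n. word_eval G g l = word_eval G g r"
    and "list_mult G (map g [1..<n]) = f Delta"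
proof -
  note R = rels[unfolded two_gen_rels_hold_iff[OF f]]
  interpret T: two_generator_braid G n "f Delta1" "f Delta"
    using n f R by unfold_locales auto
  have gs: "g = T.s" by (simp add: g_def T.s_def fun_eq_iff)
  show g: "g \<in> sphere_gens n \<rightarrow> carrier G" by (simp add: gs)
  show P: "list_mult G (map g [1..<n]) = f Delta" unfolding gs by (rule T.product_s)
  \<comment> \<open>The third relation enters here, as the sphere relation up to
    conjugation.\<close>
  have "f Delta \<otimes> list_mult G (map T.s (rev [1..<Suc (n - 1)])) = \<one>"
    using conj_sequence.full_twist_iff[OF T.conj_sequence_s, of "n - 1"] n R[THEN conjunct2, THEN conjunct2]
    by simp
  then have "f Delta \<otimes> list_mult G (map g (rev [1..<n])) = \<one>"
    using n gs by simp
  moreover have "g i \<otimes> g j = g j \<otimes> g i" if "1 \<le> i" "i + 2 \<le> j" "j < n" for i j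
    using T.s_far_commute[of i "j - i"] that unfolding gs by simp
  moreover have "g i \<otimes> g (i + 1) \<otimes> g i = g (i + 1) \<otimes> g i \<otimes> g (i + 1)"
    if "1 \<le> i" "i + 1 < n" for i
    using T.s_braid[of i] that unfolding gs by simp
  ultimately show "\<forall>(l, r) \<in> sphere_rels n. word_eval G g l = word_eval G g r"
    unfolding sphere_rels_hold_iff[OF n g] P by blast
qed

text \<open>The converse passage. The last claim recovers each \<open>s i\<close> from the two
  elements, as the other composite requires.\<close>

lemma (in group) two_gen_rels_hold_of_sphere_rels:
  assumes n: "n \<ge> 2" and s: "s \<in> sphere_gens n \<rightarrow> carrier G"
    and rels: "\<forall>(l, r) \<in> sphere_rels n. word_eval G s l = word_eval G s r"
    and f: "f Delta1 = s 1" "f Delta = list_mult G (map s [1..<n])"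
  shows "f \<in> {Delta1, Delta} \<rightarrow> carrier G"
    and "\<forall>(l, r) \<in> two_gen_rels n. word_eval G f l = word_eval G f r"
    and "\<And>i. i \<in> sphere_gens n \<Longrightarrow> f Delta [^] (i - 1) \<otimes> f Delta1 \<otimes> inv (f Delta [^] (i - 1)) = s i"
proof -
  let ?d = "list_mult G (map s [1..<n])"
  note R = rels[unfolded sphere_rels_hold_iff[OF n s]]
  have c: "s i \<in> carrier G" if "1 \<le> i" "i < n" for i
    using s that by (auto simp: sphere_gens_def)
  have d: "?d \<in> carrier G" using c by (intro list_mult_closed) auto
  have s1: "s 1 \<in> carrier G" using c n by auto
  interpret C: conj_sequence G s ?d "n - 1"
  proof
    fix i
    assume "1 \<le> i" "i < n - 1"
    then have "?d \<otimes> s i = s (i + 1) \<otimes> ?d"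
      using R c by (intro braid_product_shift) auto
    then show "?d \<otimes> s i = s (Suc i) \<otimes> ?d" by simp
  qed (use c d in auto)
  show fc: "f \<in> {Delta1, Delta} \<rightarrow> carrier G" using f s1 d by auto
  show "f Delta [^] (i - 1) \<otimes> f Delta1 \<otimes> inv (f Delta [^] (i - 1)) = s i"
    if "i \<in> sphere_gens n" for i
    using C.conj_pow[of 1 "i - 1"] that unfolding f by (auto simp: sphere_gens_def)
  \<comment> \<open>From 2 \<le> i and 2i \<le> n follows i + 2 \<le> n, so the index 1 + i is at
    most n - 1 and the conjugate is a sphere generator at distance at least 2 from the
    first.\<close>
  have "s 1 \<otimes> (?d [^] i \<otimes> s 1 \<otimes> inv (?d [^] i)) = ?d [^] i \<otimes> s 1 \<otimes> inv (?d [^] i) \<otimes> s 1"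
    if "2 \<le> i" "2 * i \<le> n" for i
  proof -
    have "?d [^] i \<otimes> s 1 \<otimes> inv (?d [^] i) = s (1 + i)"
      using that by (intro C.conj_pow) auto
    with R[THEN conjunct1, rule_format, of 1 "1 + i"] that show ?thesis by simp
  qed
  moreover have "?d [^] n = (?d \<otimes> s 1) [^] (n - 1)"
  proof -
    \<comment> \<open>\<open>pow_mult_first\<close> reaches only the exponent m = n - 2, as the
      sequence ends at n - 1. The remaining factor \<open>?d \<otimes> s 1\<close> is split off on
      the left, and its \<open>s 1\<close> completes \<open>?Q\<close> to \<open>?d\<close>.\<close>
    obtain m where m: "n = Suc (Suc m)" using n by (metis Suc_le_D numeral_2_eq_2 Suc_le_mono)
    let ?Q = "list_mult G (map s [2..<n])"
    have Q: "?Q \<in> carrier G" using c by (intro list_mult_closed) auto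
    have "(?d \<otimes> s 1) [^] (n - 1) = ?d \<otimes> s 1 \<otimes> (?d \<otimes> s 1) [^] m"
      using d s1 nat_pow_Suc2[of "?d \<otimes> s 1" m] m by simp
    also have "(?d \<otimes> s 1) [^] m = ?Q \<otimes> ?d [^] m"
      using C.pow_mult_first[of m] m by simp
    also have "?d \<otimes> s 1 \<otimes> (?Q \<otimes> ?d [^] m) = ?d \<otimes> (s 1 \<otimes> ?Q) \<otimes> ?d [^] m"
      using d s1 Q by (simp add: m_assoc)
    also have "s 1 \<otimes> ?Q = ?d"
      using n upt_conv_Cons[of 1 n] by (simp add: numeral_2_eq_2)
    also have "?d \<otimes> ?d \<otimes> ?d [^] m = ?d [^] n"
      unfolding m nat_pow_Suc2[OF d[unfolded m]] using d m by (simp add: m_assoc)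
    finally show ?thesis ..
  qed
  moreover have "?d [^] n \<otimes> (s 1 \<otimes> inv ?d) [^] (n - 1) = \<one>"
  proof -
    have "Suc (n - 1) = n" using n by simp
    then show ?thesis
      using C.full_twist_iff n R by simp
  qed
  ultimately show "\<forall>(l, r) \<in> two_gen_rels n. word_eval G f l = word_eval G f r"
    unfolding two_gen_rels_hold_iff[OF fc] f by blast
qed

section \<open>The two mutually inverse homomorphisms\<close>

lemma (in group_hom) hom_list_mult:
  "set xs \<subseteq> carrier G \<Longrightarrow> h (list_mult G xs) = list_mult H (map h xs)"
  by (induction xs) auto

theorem mainTheorem3:
  fixes n :: nat
  assumes "n \<ge> 2"
  shows "has_presentation (sphere_braid_group n) {Delta1, Delta} (two_gen_interp n) (two_gen_rels n)"
proof -
  let ?T = "{Delta1, Delta}" and ?Q = "two_gen_rels n"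
  let ?B = "sphere_braid_group n" and ?P = "presented_group ?T ?Q"
  let ?s = "sphere_delta_i n" and ?f = "two_gen_interp n"
  let ?g = "\<lambda>x. pres_class ?T ?Q (gen x)"
  \<comment> \<open>The prospective images of the \<delta>_i in the two-generator group.\<close>
  define t where "t i = ?g Delta [^]\<^bsub>?P\<^esub> (i - 1) \<otimes>\<^bsub>?P\<^esub> ?g Delta1 \<otimes>\<^bsub>?P\<^esub>
    inv\<^bsub>?P\<^esub> (?g Delta [^]\<^bsub>?P\<^esub> (i - 1))" for i :: nat
  interpret B: group ?B
    unfolding sphere_braid_group_def by (rule group_presented_group)
  interpret P: group ?P by (rule group_presented_group)
  have s: "?s \<in> sphere_gens n \<rightarrow> carrier ?B"
    by (simp add: sphere_delta_i_def sphere_braid_group_def pres_class_closed)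
  have rels: "\<forall>(l, r) \<in> sphere_rels n. word_eval ?B ?s l = word_eval ?B ?s r"
    unfolding sphere_braid_group_def sphere_delta_i_def[abs_def]
    by (rule word_eval_pres_class_relations[OF sphere_rels_words[OF assms]])
  have f_simps: "?f Delta1 = ?s 1" "?f Delta = list_mult ?B (map ?s [1..<n])"
    by (simp_all add: two_gen_interp_def sphere_delta_def list_mult_def)
  note f = B.two_gen_rels_hold_of_sphere_rels[OF assms s rels f_simps]
  have g: "?g \<in> ?T \<rightarrow> carrier ?P" by (intro funcsetI pres_class_closed) simp
  have "\<forall>(l, r) \<in> ?Q. word_eval ?P ?g l = word_eval ?P ?g r"
    by (rule word_eval_pres_class_relations[OF two_gen_rels_words])
  note t = P.sphere_rels_hold_of_two_gen_rels[OF assms g this, folded t_def[abs_def]]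
  \<comment> \<open>\<open>\<phi>\<close> runs in the direction that \<open>has_presentation\<close>
    asks for; \<open>\<psi>\<close> will be its inverse.\<close>
  obtain \<phi> where \<phi>: "\<phi> \<in> hom ?P ?B" "\<And>x. x \<in> ?T \<Longrightarrow> \<phi> (?g x) = ?f x"
    by (rule B.presented_group_hom_exists[OF f(1,2)]) (rule that)
  obtain \<psi> where "\<psi> \<in> hom (presented_group (sphere_gens n) (sphere_rels n)) ?P"
    "\<And>i. i \<in> sphere_gens n \<Longrightarrow> \<psi> (pres_class (sphere_gens n) (sphere_rels n) (gen i)) = t i"
    by (rule P.presented_group_hom_exists[OF t(1,2)]) (rule that)
  note \<psi> = this[folded sphere_braid_group_def sphere_delta_i_def]
  interpret \<phi>: group_hom ?P ?B \<phi>
    by (intro group_hom.intro group_hom_axioms.intro P.is_group B.is_group \<phi>(1))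
  interpret \<psi>: group_hom ?B ?P \<psi>
    by (intro group_hom.intro group_hom_axioms.intro P.is_group B.is_group \<psi>(1))
  have gc: "?g Delta1 \<in> carrier ?P" "?g Delta \<in> carrier ?P"
    using funcset_mem[OF g, of Delta1] funcset_mem[OF g, of Delta] by simp_all
  \<comment> \<open>\<open>\<phi>\<close> turns the formula for \<open>t i\<close> into the same
    formula in \<delta>_1 and \<delta>, which \<open>f(3)\<close> evaluates to \<delta>_i.\<close>
  have \<phi>_t: "\<phi> (t i) = ?s i" if "i \<in> sphere_gens n" for i
  proof -
    have "\<phi> (t i) = \<phi> (?g Delta) [^]\<^bsub>?B\<^esub> (i - 1) \<otimes>\<^bsub>?B\<^esub> \<phi> (?g Delta1) \<otimes>\<^bsub>?B\<^esub>
        inv\<^bsub>?B\<^esub> (\<phi> (?g Delta) [^]\<^bsub>?B\<^esub> (i - 1))"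
      unfolding t_def using gc by (simp only: \<phi>.hom_mult \<phi>.hom_inv \<phi>.hom_nat_pow
        P.m_closed P.inv_closed P.nat_pow_closed)
    then show ?thesis
      using f(3)[OF that] by (simp only: \<phi>(2)[OF insertI1] \<phi>(2)[OF insertI2[OF singletonI]])
  qed
  have \<psi>_f: "\<psi> (?f x) = ?g x" if "x \<in> ?T" for x
  proof (cases x)
    case Delta1
    have "t 1 = ?g Delta1" using gc by (simp add: t_def)
    moreover have "1 \<in> sphere_gens n" using assms by (simp add: sphere_gens_def)
    ultimately show ?thesis
      using \<psi>(2)[of 1] unfolding Delta1 f_simps by (simp only:)
  next
    case Delta
    \<comment> \<open>Under \<open>\<psi>\<close> the product \<delta> becomes the product of the
      \<open>t i\<close>, which \<open>t(3)\<close> identifies with the generator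
      \<open>Delta\<close>.\<close>
    have "set (map ?s [1..<n]) \<subseteq> carrier ?B" using s by (auto simp: sphere_gens_def)
    then have "\<psi> (?f Delta) = list_mult ?P (map \<psi> (map ?s [1..<n]))"
      unfolding f_simps by (rule \<psi>.hom_list_mult)
    also have "map \<psi> (map ?s [1..<n]) = map t [1..<n]"
      unfolding map_map by (rule map_cong[OF refl]) (auto simp: sphere_gens_def \<psi>(2))
    finally show ?thesis unfolding Delta t(3) .
  qed
  have "\<phi> \<in> iso ?P ?B"
    unfolding sphere_braid_group_def
  proof (rule presented_group_isoI)
    show "\<phi> \<in> hom ?P (presented_group (sphere_gens n) (sphere_rels n))"
      by (rule \<phi>(1)[unfolded sphere_braid_group_def])
    show "\<psi> \<in> hom (presented_group (sphere_gens n) (sphere_rels n)) ?P"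
      by (rule \<psi>(1)[unfolded sphere_braid_group_def])
    show "\<psi> (\<phi> (?g x)) = ?g x" if "x \<in> ?T" for x
      using \<phi>(2)[OF that] \<psi>_f[OF that] by (simp only:)
    show "\<phi> (\<psi> (pres_class (sphere_gens n) (sphere_rels n) (gen i))) =
        pres_class (sphere_gens n) (sphere_rels n) (gen i)" if "i \<in> sphere_gens n" for i
      using \<psi>(2)[OF that] \<phi>_t[OF that] unfolding sphere_delta_i_def by (simp only:)
  qed
  then show ?thesis
    unfolding has_presentation_def
    using \<phi>(2) by (intro conjI B.is_group f(1) two_gen_rels_words bexI[of _ \<phi>] ballI)
qed

end
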